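(* Let $\phi=\{\phi_n(r)\}_{n=0}^{\infty}\in\mathcal{G}$ and let $m\ge 2$ be an integer. (1) If $r=0$ is the only zero of $\phi_1(r)$ in $[0,1)$, then $R_{\phi}(\mathbb{D},\mathbb{C}^m_{\infty})=0$. (2) Let $1\le p<\infty$. If $\phi_0(r)=1$ and $\phi_1(r)=\alpha r^{\beta}$ for all $r\in[0,1)$, for some $\alpha,\beta\in(0,\infty)$, then $R_{\phi}(\mathbb{D},\mathbb{C}^m_p)=0$.
   Context: $\mathbb{D}=\{z\in\mathbb{C}:|z|<1\}$. $\mathcal{G}$ is the set of all sequences $\phi=\{\phi_n(r)\}_{n=0}^{\infty}$ of non-negative continuous functions on $[0,1)$ such that $\sum_{n=0}^{\infty}\phi_n(r)$ converges locally uniformly with respect to $r\in[0,1)$. $\mathbb{C}^m_p$ is $\mathbb{C}^m$ with the norm $\|w\|_p=(\sum_{i=1}^m|w_i|^p)^{1/p}$ for $1\le p<\infty$, and $\mathbb{C}^m_\infty$ is $\mathbb{C}^m$ with $\|w\|_\infty=\sup_{1\le i\le m}|w_i|$. For a complex Banach space $X$, $H^{\infty}(\mathbb{D},X)$ is the space of bounded analytic functions $f:\mathbb{D}\to X$, with $\|f\|_{H^\infty(\mathbb{D},X)}=\sup_{z\in\mathbb{D}}\|f(z)\|$. For $f(z)=\sum_{n=0}^\infty x_nz^n$ in $H^\infty(\mathbb{D},X)$ with $\|f\|_{H^\infty(\mathbb{D},X)}\le 1$ and $\phi\in\mathcal{G}$, put $$R_\phi(f,\mathbb{D},X)=\sup\Big\{r\in[0,1):\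 \sum_{n=0}^\infty\|x_n\|\phi_n(r)\le\phi_0(r)\Big\},$$ and $R_\phi(\mathbb{D},X)=\inf\{R_\phi(f,\mathbb{D},X):\ \|f\|_{H^\infty(\mathbb{D},X)}\le 1\}$. *)

theory Defs
  imports "HOL-Analysis.Analysis"
begin

definition class_G :: "(nat \<Rightarrow> real \<Rightarrow> real) set" where
  "class_G = {\<phi>.
     (\<forall>n. continuous_on {0..<1} (\<phi> n) \<and> (\<forall>r\<in>{0..<1}. 0 \<le> \<phi> n r)) \<and>
     (\<forall>r\<in>{0..<1}. \<exists>U. open U \<and> r \<in> U \<and>
        uniformly_convergent_on (U \<inter> {0..<1}) (\<lambda>N s. \<Sum>n<N. \<phi> n s))}"

text \<open>A complex Banach space \<open>X\<close> is given by an additive group, its complex scalar multiplication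
  \<open>smul\<close> and its norm \<open>nrm\<close>. These are explicit parameters rather than a type class because the
  spaces of interest are one vector space carrying a family of norms. All limits are taken with
  respect to \<open>nrm\<close>. Only the values of \<open>f\<close> on the unit disc matter.\<close>

definition analytic_disc ::
  "(complex \<Rightarrow> 'v \<Rightarrow> 'v) \<Rightarrow> ('v \<Rightarrow> real) \<Rightarrow> (complex \<Rightarrow> 'v::ab_group_add) \<Rightarrow> bool" where
  "analytic_disc smul nrm f \<longleftrightarrow>
     (\<forall>z\<in>ball 0 1. \<exists>d. ((\<lambda>w. nrm (smul (1 / (w - z)) (f w - f z) - d)) \<longlongrightarrow> 0) (at z))"

definition H_inf ::
  "(complex \<Rightarrow> 'v \<Rightarrow> 'v) \<Rightarrow> ('v \<Rightarrow> real) \<Rightarrow> (complex \<Rightarrow> 'v::ab_group_add) set" where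
  "H_inf smul nrm = {f. analytic_disc smul nrm f \<and> bdd_above ((\<lambda>z. nrm (f z)) ` ball 0 1)}"

definition H_inf_norm :: "('v \<Rightarrow> real) \<Rightarrow> (complex \<Rightarrow> 'v) \<Rightarrow> real" where
  "H_inf_norm nrm f = (SUP z\<in>ball 0 1. nrm (f z))"

text \<open>The coefficient sequence \<open>x\<close> in \<open>f z = (\<Sum>n. x\<^sub>n z\<^sup>n)\<close> on the unit disc.\<close>

definition power_coeffs ::
  "(complex \<Rightarrow> 'v \<Rightarrow> 'v) \<Rightarrow> ('v \<Rightarrow> real) \<Rightarrow> (complex \<Rightarrow> 'v::ab_group_add) \<Rightarrow> nat \<Rightarrow> 'v" where
  "power_coeffs smul nrm f =
     (THE x. \<forall>z\<in>ball 0 1. (\<lambda>N. nrm (f z - (\<Sum>n<N. smul (z ^ n) (x n)))) \<longlonglongrightarrow> 0)"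

text \<open>The supremum is that of a subset of \<open>[0,1)\<close>, so the supremum of the empty set is \<open>0\<close>;
  inserting \<open>0\<close> implements this convention and changes nothing for a nonempty set.\<close>

definition bohr_radius_fun ::
  "(nat \<Rightarrow> real \<Rightarrow> real) \<Rightarrow> (complex \<Rightarrow> 'v \<Rightarrow> 'v) \<Rightarrow> ('v \<Rightarrow> real) \<Rightarrow>
    (complex \<Rightarrow> 'v::ab_group_add) \<Rightarrow> real" where
  "bohr_radius_fun \<phi> smul nrm f = Sup (insert 0 {r\<in>{0..<1}.
     summable (\<lambda>n. nrm (power_coeffs smul nrm f n) * \<phi> n r) \<and>
     (\<Sum>n. nrm (power_coeffs smul nrm f n) * \<phi> n r) \<le> \<phi> 0 r})"

definition bohr_radius ::
  "(nat \<Rightarrow> real \<Rightarrow> real) \<Rightarrow> (complex \<Rightarrow> 'v \<Rightarrow> 'v) \<Rightarrow> ('v::ab_group_add \<Rightarrow> real) \<Rightarrow> real" where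
  "bohr_radius \<phi> smul nrm =
     (INF f\<in>{f \<in> H_inf smul nrm. H_inf_norm nrm f \<le> 1}. bohr_radius_fun \<phi> smul nrm f)"

definition lp_norm :: "real \<Rightarrow> complex ^ 'm \<Rightarrow> real" where
  "lp_norm p w = (\<Sum>i\<in>UNIV. norm (w $ i) powr p) powr (1 / p)"

definition linf_norm :: "complex ^ 'm \<Rightarrow> real" where
  "linf_norm w = (SUP i. norm (w $ i))"

end

theory Submission
  imports Defs
begin

text \<open>The Bohr radius is an infimum of nonnegative numbers, so it vanishes as soon as there are
  functions of norm at most one whose individual radii are arbitrarily small. Affine functions
  \<open>f z = u + z v\<close> suffice, because then only \<open>\<phi>\<^sub>0\<close> and \<open>\<phi>\<^sub>1\<close> enter and the condition that defines
  the radius reads \<open>\<parallel>u\<parallel> \<phi>\<^sub>0(r) + \<parallel>v\<parallel> \<phi>\<^sub>1(r) \<le> \<phi>\<^sub>0(r)\<close>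
  (lemma \<open>bohr_radius_eq_0_if_affine_witnesses\<close>).

  In the supremum norm, \<open>f z = (1, z, 0, \<dots>)\<close> has \<open>\<parallel>u\<parallel> = \<parallel>v\<parallel> = 1\<close>, and the condition fails wherever
  \<open>\<phi>\<^sub>1\<close> is positive. In the \<open>p\<close>-norms with finite \<open>p\<close> such a choice is impossible, but it is enough
  to move a distance of first order in \<open>t\<close> at the price of a norm defect \<open>1 - \<parallel>u\<parallel>\<close> that is of
  higher order: then \<open>\<parallel>u\<parallel> + c \<parallel>v\<parallel> > 1\<close> for small \<open>t\<close>, however small the constant \<open>c > 0\<close> is.
  For \<open>p > 1\<close> the function \<open>((1 - t\<^sup>p)\<^bsup>1/p\<^esup>, t z)\<close> has a defect of order \<open>t\<^sup>p\<close>. For \<open>p = 1\<close> that defect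
  is of order \<open>t\<close> and the example breaks down; instead, one moves along an edge of the unit
  sphere, so that the linear terms of the two moduli cancel: \<open>(a + b z, a - b z)\<close> with \<open>2 a = sqrt (1 - t\<^sup>2)\<close> and
  \<open>2 b = t\<close>, whose norm is bounded by the parallelogram law.\<close>

section \<open>Affine functions and vanishing Bohr radius\<close>

lemma powser_coeff_unique:
  fixes a b :: "nat \<Rightarrow> 'a::{real_normed_field, banach}"
  assumes a: "\<And>z. z \<in> ball 0 1 \<Longrightarrow> (\<lambda>n. a n * z ^ n) sums g z"
    and b: "\<And>z. z \<in> ball 0 1 \<Longrightarrow> (\<lambda>n. b n * z ^ n) sums g z"
  shows "a = b"
proof (rule ccontr)
  assume "a \<noteq> b"
  define d where "d n = a n - b n" for n
  have d: "(\<lambda>n. d n * z ^ n) sums 0" if "z \<in> ball 0 1" for z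
    using sums_diff[OF a[OF that] b[OF that]] by (simp add: d_def algebra_simps)
  from \<open>a \<noteq> b\<close> obtain m where "d m \<noteq> 0"
    by (auto simp: d_def fun_eq_iff)
  define k where "k = (LEAST n. d n \<noteq> 0)"
  have k: "d k \<noteq> 0"
    unfolding k_def using \<open>d m \<noteq> 0\<close> by (rule LeastI)
  have less: "d n = 0" if "n < k" for n
    using not_less_Least that unfolding k_def by blast
  \<comment> \<open>After division by \<open>z ^ k\<close>, the difference of the series tends to its first nonzero
    coefficient \<open>d k\<close> at the origin.\<close>
  have "((\<lambda>_::'a. 0::'a) \<longlongrightarrow> d (0 + k)) (at 0)"
  proof (rule powser_limit_0_strong[where s = 1 and a = "\<lambda>n. d (n + k)"])
    fix z :: 'a
    assume z: "z \<noteq> 0" "norm z < 1"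
    have "(\<lambda>n. d (n + k) * z ^ (n + k)) sums 0"
      using d[of z] z sums_iff_shift[of "\<lambda>n. d n * z ^ n" k 0] less by simp
    from sums_divide[OF this, of "z ^ k"] show "(\<lambda>n. d (n + k) * z ^ n) sums 0"
      using z by (simp add: power_add)
  qed simp
  then have "d k = 0"
    by (simp add: tendsto_const_iff)
  with k show False ..
qed

text \<open>The norm enters only through two properties, which cover all the norms considered below: it
  dominates each coordinate, so that the expansion can be compared coordinatewise, and it vanishes
  at \<open>0\<close>, so that the finite expansion converges.\<close>

lemma power_coeffs_affine:
  fixes u v :: "complex ^ 'm" and nrm :: "complex ^ 'm \<Rightarrow> real"
  assumes zero: "nrm 0 = 0"
    and coord: "\<And>w i. norm (w $ i) \<le> nrm w"
  shows "power_coeffs (*s) nrm (\<lambda>z. u + z *s v) = (\<lambda>n. if n = 0 then u else if n = 1 then v else 0)"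
    (is "_ = ?x")
proof -
  let ?expands = "\<lambda>y. \<forall>z\<in>ball 0 1. (\<lambda>N. nrm (u + z *s v - (\<Sum>n<N. z ^ n *s y n))) \<longlonglongrightarrow> 0"
  have x: "?expands ?x"
  proof
    fix z :: complex
    have "(\<Sum>n<N. z ^ n *s ?x n) = u + z *s v" if "N \<ge> 2" for N
    proof -
      have "(\<Sum>n<N. z ^ n *s ?x n) = (\<Sum>n<2. z ^ n *s ?x n)"
        using that by (intro sum.mono_neutral_right) auto
      then show ?thesis
        by (simp add: numeral_2_eq_2)
    qed
    then have "\<forall>\<^sub>F N in sequentially. nrm (u + z *s v - (\<Sum>n<N. z ^ n *s ?x n)) = 0"
      by (intro eventually_sequentiallyI[of 2]) (simp add: zero)
    then show "(\<lambda>N. nrm (u + z *s v - (\<Sum>n<N. z ^ n *s ?x n))) \<longlonglongrightarrow> 0"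
      by (rule tendsto_eventually)
  qed
  \<comment> \<open>Any \<open>nrm\<close>-expansion converges in each coordinate, where power series coefficients are unique.\<close>
  have coord_sums: "(\<lambda>n. y n $ i * z ^ n) sums ((u + z *s v) $ i)"
    if y: "?expands y"
      and z: "z \<in> ball 0 1" for y :: "nat \<Rightarrow> complex ^ 'm" and z i
  proof -
    have "(\<lambda>N. (\<Sum>n<N. y n $ i * z ^ n) - (u + z *s v) $ i) \<longlonglongrightarrow> 0"
    proof (rule Lim_null_comparison)
      show "(\<lambda>N. nrm (u + z *s v - (\<Sum>n<N. z ^ n *s y n))) \<longlonglongrightarrow> 0"
        using y z by blast
      have "norm ((\<Sum>n<N. y n $ i * z ^ n) - (u + z *s v) $ i)
          = norm ((u + z *s v - (\<Sum>n<N. z ^ n *s y n)) $ i)" for N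
        by (simp add: norm_minus_commute mult.commute)
      then show "\<forall>\<^sub>F N in sequentially. norm ((\<Sum>n<N. y n $ i * z ^ n) - (u + z *s v) $ i)
          \<le> nrm (u + z *s v - (\<Sum>n<N. z ^ n *s y n))"
        by (simp only: coord) simp
    qed
    then show ?thesis
      unfolding sums_def by (simp add: LIM_zero_iff)
  qed
  have unique: "y = ?x" if y: "?expands y" for y
  proof -
    have "(\<lambda>n. y n $ i) = (\<lambda>n. ?x n $ i)" for i
      using coord_sums[OF y, of _ i] coord_sums[OF x, of _ i] by (rule powser_coeff_unique)
    then have "y n $ i = ?x n $ i" for n i
      by (rule fun_cong)
    then have "y n = ?x n" for n
      unfolding vec_eq_iff by blast
    then show ?thesis ..
  qed
  show ?thesis
    unfolding power_coeffs_def using x unique by (rule the_equality)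
qed

lemma affine_in_H_inf:
  fixes u v :: "complex ^ 'm" and nrm :: "complex ^ 'm \<Rightarrow> real"
  assumes zero: "nrm 0 = 0"
    and bound: "\<And>z. z \<in> ball 0 1 \<Longrightarrow> nrm (u + z *s v) \<le> 1"
  shows "(\<lambda>z. u + z *s v) \<in> H_inf (*s) nrm" "H_inf_norm nrm (\<lambda>z. u + z *s v) \<le> 1"
proof -
  have "analytic_disc (*s) nrm (\<lambda>z. u + z *s v)"
    unfolding analytic_disc_def
  proof (intro ballI exI)
    fix z :: complex
    have "(1 / (w - z)) *s ((u + w *s v) - (u + z *s v)) - v = 0" if "w \<noteq> z" for w
      using that by (simp add: vec_eq_iff field_simps)
    then have "\<forall>\<^sub>F w in at z. nrm ((1 / (w - z)) *s ((u + w *s v) - (u + z *s v)) - v) = 0"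
      by (simp add: eventually_at_filter zero)
    then show "((\<lambda>w. nrm ((1 / (w - z)) *s ((u + w *s v) - (u + z *s v)) - v)) \<longlongrightarrow> 0) (at z)"
      by (rule tendsto_eventually)
  qed
  moreover have "bdd_above ((\<lambda>z. nrm (u + z *s v)) ` ball 0 1)"
    using bound by (intro bdd_aboveI2)
  ultimately show "(\<lambda>z. u + z *s v) \<in> H_inf (*s) nrm"
    by (simp add: H_inf_def)
  show "H_inf_norm nrm (\<lambda>z. u + z *s v) \<le> 1"
    unfolding H_inf_norm_def using bound by (intro cSUP_least) auto
qed

lemma bohr_radius_fun_nonneg: "0 \<le> bohr_radius_fun \<phi> smul nrm f"
  unfolding bohr_radius_fun_def
  by (intro cSup_upper bdd_aboveI[of _ 1]) auto

lemma bohr_radius_fun_affine_le: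
  fixes u v :: "complex ^ 'm" and nrm :: "complex ^ 'm \<Rightarrow> real"
  assumes zero: "nrm 0 = 0"
    and coord: "\<And>w i. norm (w $ i) \<le> nrm w"
    and "0 \<le> \<epsilon>"
    and exceed: "\<And>r. \<epsilon> < r \<Longrightarrow> r < 1 \<Longrightarrow> \<phi> 0 r < nrm u * \<phi> 0 r + nrm v * \<phi> 1 r"
  shows "bohr_radius_fun \<phi> (*s) nrm (\<lambda>z. u + z *s v) \<le> \<epsilon>"
proof -
  let ?x = "\<lambda>n. if n = 0 then u else if n = 1 then v else 0"
  have suminf: "(\<Sum>n. nrm (?x n) * \<phi> n r) = nrm u * \<phi> 0 r + nrm v * \<phi> 1 r" for r
    by (subst suminf_finite[of "{0,1}"]) (auto simp: zero)
  show ?thesis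
    unfolding bohr_radius_fun_def power_coeffs_affine[OF zero coord] suminf
    using \<open>0 \<le> \<epsilon>\<close> exceed by (intro cSup_least) (auto simp: not_less[symmetric])
qed

text \<open>The witness may depend on \<open>\<epsilon>\<close>. The \<open>p\<close>-norms with finite \<open>p\<close> require this freedom, because
  there the function has to be adapted to the size of \<open>\<phi>\<^sub>1\<close> on \<open>(\<epsilon>, 1)\<close>.\<close>

lemma bohr_radius_eq_0_if_affine_witnesses:
  fixes nrm :: "complex ^ 'm \<Rightarrow> real"
  assumes zero: "nrm 0 = 0"
    and coord: "\<And>w i. norm (w $ i) \<le> nrm w"
    and witness: "\<And>\<epsilon>. 0 < \<epsilon> \<Longrightarrow> \<exists>u v. (\<forall>z\<in>ball 0 1. nrm (u + z *s v) \<le> 1) \<and>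
      (\<forall>r. \<epsilon> < r \<and> r < 1 \<longrightarrow> \<phi> 0 r < nrm u * \<phi> 0 r + nrm v * \<phi> 1 r)"
  shows "bohr_radius \<phi> (*s) nrm = 0"
proof (rule antisym)
  let ?B = "{f \<in> H_inf (*s) nrm. H_inf_norm nrm f \<le> 1}"
  have small: "\<exists>f\<in>?B. bohr_radius_fun \<phi> (*s) nrm f \<le> \<epsilon>" if \<epsilon>: "0 < \<epsilon>" for \<epsilon>
  proof -
    obtain u v where uv: "\<forall>z\<in>ball 0 1. nrm (u + z *s v) \<le> 1"
      "\<forall>r. \<epsilon> < r \<and> r < 1 \<longrightarrow> \<phi> 0 r < nrm u * \<phi> 0 r + nrm v * \<phi> 1 r"
      using witness[OF \<epsilon>] by blast
    show ?thesis
    proof (rule bexI)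
      show "(\<lambda>z. u + z *s v) \<in> ?B"
        using uv(1) affine_in_H_inf[of nrm, OF zero] by auto
      show "bohr_radius_fun \<phi> (*s) nrm (\<lambda>z. u + z *s v) \<le> \<epsilon>"
        using uv(2) \<epsilon> by (intro bohr_radius_fun_affine_le[OF zero coord]) auto
    qed
  qed
  show "0 \<le> bohr_radius \<phi> (*s) nrm"
    unfolding bohr_radius_def
  proof (rule cINF_greatest)
    show "?B \<noteq> {}"
      using small[of 1] by auto
  qed (rule bohr_radius_fun_nonneg)
  show "bohr_radius \<phi> (*s) nrm \<le> 0"
  proof (rule field_le_epsilon)
    fix \<epsilon> :: real
    assume "0 < \<epsilon>"
    from small[OF this] obtain f where f: "f \<in> ?B" "bohr_radius_fun \<phi> (*s) nrm f \<le> \<epsilon>" ..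
    have "bdd_below (bohr_radius_fun \<phi> (*s) nrm ` ?B)"
      using bohr_radius_fun_nonneg by (intro bdd_belowI2)
    then have "bohr_radius \<phi> (*s) nrm \<le> bohr_radius_fun \<phi> (*s) nrm f"
      unfolding bohr_radius_def using f(1) by (rule cINF_lower)
    with f(2) show "bohr_radius \<phi> (*s) nrm \<le> 0 + \<epsilon>"
      by simp
  qed
qed

section \<open>Norms of vectors supported on two coordinates\<close>

definition two_coords :: "'m \<Rightarrow> 'm \<Rightarrow> complex \<Rightarrow> complex \<Rightarrow> complex ^ 'm" where
  "two_coords i j a b = (\<chi> k. if k = i then a else if k = j then b else 0)"

lemma two_coords_affine:
  "two_coords i j a b + z *s two_coords i j c d = two_coords i j (a + z * c) (b + z * d)"
  by (simp add: two_coords_def vec_eq_iff)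

lemma linf_norm_two_coords:
  fixes i j :: "'m::finite"
  assumes "i \<noteq> j"
  shows "linf_norm (two_coords i j a b) = max (norm a) (norm b)"
proof (rule antisym)
  have *: "norm (two_coords i j a b $ k) \<le> linf_norm (two_coords i j a b)" for k
    unfolding linf_norm_def by (intro cSUP_upper) auto
  show "max (norm a) (norm b) \<le> linf_norm (two_coords i j a b)"
    using *[of i] *[of j] assms by (simp add: two_coords_def)
  show "linf_norm (two_coords i j a b) \<le> max (norm a) (norm b)"
    unfolding linf_norm_def two_coords_def by (intro cSUP_least) (auto simp: le_max_iff_disj)
qed

lemma lp_norm_two_coords:
  assumes "i \<noteq> j"
  shows "lp_norm p (two_coords i j a b) = (norm a powr p + norm b powr p) powr (1 / p)"
proof -
  have "(\<Sum>k\<in>UNIV. norm (two_coords i j a b $ k) powr p)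
      = (\<Sum>k\<in>{i, j}. norm (two_coords i j a b $ k) powr p)"
    by (intro sum.mono_neutral_right) (auto simp: two_coords_def)
  also have "\<dots> = norm a powr p + norm b powr p"
    using assms by (simp add: two_coords_def)
  finally show ?thesis
    by (simp add: lp_norm_def)
qed

lemma norm_coord_le_linf_norm: "norm (w $ i) \<le> linf_norm w"
  unfolding linf_norm_def by (intro cSUP_upper) auto

lemma norm_coord_le_lp_norm:
  assumes "0 < p"
  shows "norm (w $ i) \<le> lp_norm p w"
proof -
  have "norm (w $ i) = (norm (w $ i) powr p) powr (1 / p)"
    using assms by (simp add: powr_powr)
  also have "\<dots> \<le> lp_norm p w"
    unfolding lp_norm_def using assms
    by (intro powr_mono2 member_le_sum) auto
  finally show ?thesis .
qed

section \<open>Affine functions with a norm defect of higher order\<close>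

text \<open>With \<open>u = ((1 - t\<^sup>p)\<^bsup>1/p\<^esup>, 0)\<close> and \<open>v = (0, t)\<close>, the \<open>p\<close>-th powers of the coordinates add up to at
  most \<open>1\<close> on the disc, and \<open>\<parallel>u\<parallel> \<ge> 1 - t\<^sup>p\<close>. Hence the gain \<open>c t\<close> beats the defect as soon as
  \<open>t\<^bsup>p-1\<^esup> < c\<close>, which small positive \<open>t\<close> satisfy because the exponent is positive.\<close>

lemma lp_affine_gain:
  fixes i j :: "'m::finite"
  assumes "i \<noteq> j" "1 < p" "0 < c"
  obtains u v :: "complex ^ 'm"
  where "\<forall>z\<in>ball 0 1. lp_norm p (u + z *s v) \<le> 1" "1 < lp_norm p u + c * lp_norm p v"
proof -
  define t where "t = min (1/2) (c/2) powr (1 / (p - 1))"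
  have t: "0 < t" "t powr (p - 1) < c"
    using assms by (auto simp: t_def powr_powr)
  have "t powr (p - 1) < 1"
    using assms by (auto simp: t_def powr_powr)
  then have "t < 1"
    using t(1) \<open>1 < p\<close> by (meson ge_one_powr_ge_zero not_less diff_ge_0_iff_ge less_imp_le)
  have tp: "t powr p = t * t powr (p - 1)"
    using t(1) by (simp add: powr_diff)
  define s where "s = 1 - t powr p"
  have s: "0 \<le> s" "s \<le> 1"
    using \<open>t < 1\<close> t(1) assms by (auto simp: s_def powr_le1)
  let ?u = "two_coords i j (of_real (s powr (1 / p))) 0"
  let ?v = "two_coords i j 0 (of_real t)"
  have norm_u: "lp_norm p ?u = s powr (1 / p)" and norm_v: "lp_norm p ?v = t"
    using assms t(1) s by (simp_all add: lp_norm_two_coords powr_powr)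
  show thesis
  proof
    show "\<forall>z\<in>ball 0 1. lp_norm p (?u + z *s ?v) \<le> 1"
    proof
      fix z :: complex
      assume "z \<in> ball 0 1"
      then have "(norm z * t) powr p \<le> t powr p"
        using t(1) assms by (intro powr_mono2) (auto intro!: mult_left_le_one_le)
      then show "lp_norm p (?u + z *s ?v) \<le> 1"
        using assms t(1) s unfolding two_coords_affine lp_norm_two_coords[OF \<open>i \<noteq> j\<close>]
        by (intro powr_le1) (auto simp: norm_mult powr_powr s_def)
    qed
    \<comment> \<open>On \<open>[0, 1]\<close> taking the root \<open>1 / p \<le> 1\<close> only increases the value.\<close>
    have "s \<le> s powr (1 / p)"
      using s assms powr_mono'[of "1 / p" 1 s] by simp
    moreover have "1 - s < c * t"
      using t by (simp add: s_def tp)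
    ultimately show "1 < lp_norm p ?u + c * lp_norm p ?v"
      unfolding norm_u norm_v by simp
  qed
qed

text \<open>The parallelogram law, combined with \<open>(x + y)\<^sup>2 \<le> 2 (x\<^sup>2 + y\<^sup>2)\<close>.\<close>

lemma norm_add_norm_diff_le:
  fixes a b :: "'a::real_inner"
  shows "norm (a + b) + norm (a - b) \<le> 2 * sqrt ((norm a)\<^sup>2 + (norm b)\<^sup>2)"
proof -
  have "(norm (a + b) + norm (a - b))\<^sup>2 \<le> 2 * ((norm (a + b))\<^sup>2 + (norm (a - b))\<^sup>2)"
    using zero_le_power2[of "norm (a + b) - norm (a - b)"] by (simp add: power2_eq_square algebra_simps)
  also have "\<dots> = 4 * ((norm a)\<^sup>2 + (norm b)\<^sup>2)"
    by (simp add: power2_norm_eq_inner algebra_simps)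
  finally have "norm (a + b) + norm (a - b) \<le> sqrt (4 * ((norm a)\<^sup>2 + (norm b)\<^sup>2))"
    by (rule real_le_rsqrt)
  then show ?thesis
    by (simp only: real_sqrt_mult real_sqrt_four)
qed

text \<open>With \<open>u = (s/2, s/2)\<close>, \<open>v = (t/2, -t/2)\<close> and \<open>s\<^sup>2 + t\<^sup>2 = 1\<close>, the previous lemma bounds the norm
  on the disc by \<open>sqrt (s\<^sup>2 + t\<^sup>2) = 1\<close>. The defect \<open>1 - s\<close> is at most \<open>t\<^sup>2\<close>, so \<open>t < c\<close> suffices.\<close>

lemma l1_affine_gain:
  fixes i j :: "'m::finite"
  assumes "i \<noteq> j" "0 < c"
  obtains u v :: "complex ^ 'm"
  where "\<forall>z\<in>ball 0 1. lp_norm 1 (u + z *s v) \<le> 1" "1 < lp_norm 1 u + c * lp_norm 1 v"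
proof -
  define t where "t = min (1/2) (c/2)"
  have t: "0 < t" "t < 1" "t < c"
    using assms by (auto simp: t_def)
  define s where "s = sqrt (1 - t\<^sup>2)"
  have t2: "t\<^sup>2 \<le> 1"
    using t by (simp add: power_le_one)
  then have s: "0 \<le> s" "s\<^sup>2 = 1 - t\<^sup>2"
    by (auto simp: s_def)
  let ?u = "two_coords i j (of_real (s / 2)) (of_real (s / 2))"
  let ?v = "two_coords i j (of_real (t / 2)) (- of_real (t / 2))"
  have l1: "lp_norm 1 (two_coords i j a b) = norm a + norm b" for a b
    using assms by (simp add: lp_norm_two_coords)
  have norm_u: "lp_norm 1 ?u = s" and norm_v: "lp_norm 1 ?v = t"
    using t s by (simp_all add: l1)
  show thesis
  proof
    show "\<forall>z\<in>ball 0 1. lp_norm 1 (?u + z *s ?v) \<le> 1"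
    proof
      fix z :: complex
      assume "z \<in> ball 0 1"
      then have z: "(norm z)\<^sup>2 \<le> 1"
        by (simp add: power_le_one)
      let ?a = "of_real (s / 2) :: complex" and ?b = "z * of_real (t / 2)"
      have "lp_norm 1 (?u + z *s ?v) = norm (?a + ?b) + norm (?a - ?b)"
        unfolding two_coords_affine l1 by simp
      also have "\<dots> \<le> 2 * sqrt ((norm ?a)\<^sup>2 + (norm ?b)\<^sup>2)"
        by (rule norm_add_norm_diff_le)
      also have "(norm ?a)\<^sup>2 + (norm ?b)\<^sup>2 = (s\<^sup>2 + (norm z)\<^sup>2 * t\<^sup>2) / 4"
        by (simp add: norm_mult power_mult_distrib power_divide)
      also have "s\<^sup>2 + (norm z)\<^sup>2 * t\<^sup>2 \<le> 1"
        using z mult_right_mono[of "(norm z)\<^sup>2" 1 "t\<^sup>2"] by (simp add: s(2))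
      then have "2 * sqrt ((s\<^sup>2 + (norm z)\<^sup>2 * t\<^sup>2) / 4) \<le> 1"
        by (simp add: real_sqrt_divide)
      finally show "lp_norm 1 (?u + z *s ?v) \<le> 1" .
    qed
    have "s \<le> 1"
      by (simp add: s_def)
    then have "1 - t\<^sup>2 \<le> s"
      unfolding s(2)[symmetric] using s(1) by (simp add: power2_eq_square mult_left_le)
    moreover have "t\<^sup>2 < c * t"
      using t by (simp add: power2_eq_square)
    ultimately show "1 < lp_norm 1 ?u + c * lp_norm 1 ?v"
      unfolding norm_u norm_v by simp
  qed
qed

theorem proposition1p13:
  fixes \<phi> :: "nat \<Rightarrow> real \<Rightarrow> real"
  assumes "\<phi> \<in> class_G"
    and "CARD('m::finite) \<ge> 2"
  shows "((\<forall>r\<in>{0..<1}. \<phi> 1 r = 0 \<longleftrightarrow> r = 0) \<longrightarrow>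
            bohr_radius \<phi> (*s) (linf_norm :: complex ^ 'm \<Rightarrow> real) = 0) \<and>
         (\<forall>p \<alpha> \<beta> :: real. 1 \<le> p \<and> 0 < \<alpha> \<and> 0 < \<beta> \<and>
            (\<forall>r\<in>{0..<1}. \<phi> 0 r = 1 \<and> \<phi> 1 r = \<alpha> * r powr \<beta>) \<longrightarrow>
            bohr_radius \<phi> (*s) (lp_norm p :: complex ^ 'm \<Rightarrow> real) = 0)"
proof -
  obtain i j :: 'm where ij: "i \<noteq> j"
    using assms(2) ex_card[of 2 "UNIV :: 'm set"] by (auto simp: card_2_iff)
  have part1: "bohr_radius \<phi> (*s) (linf_norm :: complex ^ 'm \<Rightarrow> real) = 0"
    if zeros: "\<forall>r\<in>{0..<1}. \<phi> 1 r = 0 \<longleftrightarrow> r = 0"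
  proof (rule bohr_radius_eq_0_if_affine_witnesses[OF _ norm_coord_le_linf_norm])
    fix \<epsilon> :: real
    assume "0 < \<epsilon>"
    let ?u = "two_coords i j 1 0 :: complex ^ 'm" and ?v = "two_coords i j 0 1 :: complex ^ 'm"
    have "0 < \<phi> 1 r" if "0 < r" "r < 1" for r
    proof -
      have "0 \<le> \<phi> 1 r"
        using assms(1) that by (auto simp: class_G_def)
      moreover have "\<phi> 1 r \<noteq> 0"
        using zeros that by auto
      ultimately show ?thesis by simp
    qed
    then show "\<exists>u v. (\<forall>z\<in>ball 0 1. linf_norm (u + z *s v :: complex ^ 'm) \<le> 1) \<and>
      (\<forall>r. \<epsilon> < r \<and> r < 1 \<longrightarrow> \<phi> 0 r < linf_norm u * \<phi> 0 r + linf_norm v * \<phi> 1 r)"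
      using \<open>0 < \<epsilon>\<close>
      by (intro exI[of _ ?u] exI[of _ ?v]) (auto simp: two_coords_affine linf_norm_two_coords[OF ij])
  qed (simp add: linf_norm_def)
  have part2: "bohr_radius \<phi> (*s) (lp_norm p :: complex ^ 'm \<Rightarrow> real) = 0"
    if p: "1 \<le> p" and pos: "0 < \<alpha>" "0 < \<beta>"
      and \<phi>: "\<forall>r\<in>{0..<1}. \<phi> 0 r = 1 \<and> \<phi> 1 r = \<alpha> * r powr \<beta>" for p \<alpha> \<beta> :: real
  proof (rule bohr_radius_eq_0_if_affine_witnesses[OF _ norm_coord_le_lp_norm])
    fix \<epsilon> :: real
    assume \<epsilon>: "0 < \<epsilon>"
    define c where "c = \<alpha> * \<epsilon> powr \<beta>"
    have "0 < c"
      using pos \<epsilon> by (simp add: c_def)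
    obtain u v :: "complex ^ 'm" where u: "\<forall>z\<in>ball 0 1. lp_norm p (u + z *s v) \<le> 1"
      and uv: "1 < lp_norm p u + c * lp_norm p v"
    proof (cases "p = 1")
      case True
      show ?thesis
        by (rule l1_affine_gain[OF ij \<open>0 < c\<close>]) (rule that[unfolded True])
    next
      case False
      with p have "1 < p"
        by simp
      then show ?thesis
        by (rule lp_affine_gain[OF ij _ \<open>0 < c\<close>]) (rule that)
    qed
    have "\<phi> 0 r < lp_norm p u * \<phi> 0 r + lp_norm p v * \<phi> 1 r" if r: "\<epsilon> < r" "r < 1" for r
    proof -
      have "c \<le> \<phi> 1 r"
        using r \<epsilon> pos \<phi> by (auto simp: c_def intro!: powr_mono2)
      moreover have "0 \<le> lp_norm p v"
        by (simp add: lp_norm_def)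
      ultimately have "c * lp_norm p v \<le> \<phi> 1 r * lp_norm p v"
        by (rule mult_right_mono)
      moreover have "\<phi> 0 r = 1"
        using \<phi> r \<epsilon> by simp
      ultimately show ?thesis
        using uv by (simp add: mult.commute)
    qed
    with u show "\<exists>u v. (\<forall>z\<in>ball 0 1. lp_norm p (u + z *s v :: complex ^ 'm) \<le> 1) \<and>
      (\<forall>r. \<epsilon> < r \<and> r < 1 \<longrightarrow> \<phi> 0 r < lp_norm p u * \<phi> 0 r + lp_norm p v * \<phi> 1 r)"
      by blast
  qed (use p in \<open>auto simp: lp_norm_def\<close>)
  show ?thesis
    using part1 part2 by blast
qed

end
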